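(* Let $B$ be a Borel topological group which is not $\sigma$-compact, and suppose that $B$ is an $F_\sigma$-subspace or a $G_\delta$-subspace of a complete metric space. Then no subspace $X\subset B$ with the property $\bigcup_{fin}(\mathcal O,\Gamma)$ generates $B$ as a group.
   Context: A Borel space is a separable metrizable space which is a Borel subset of its completion; a Borel group is a topological group whose underlying space is Borel. A topological space $X$ has the property $\bigcup_{fin}(\mathcal O,\Gamma)$ (the Hurewicz property) if for every sequence $(u_n)_{n\in\omega}$ of open covers of $X$ there exists a sequence $(v_n)_{n\in\omega}$, where each $v_n$ is a finite subset of $u_n$, such that each $x\in X$ belongs to $\bigcup v_n$ for all but finitely many $n\in\omega$. A subset $X$ of a group $B$ generates $B$ if the smallest subgroup of $B$ containing $X$ is $B$. *)

theory Defs
  imports "HOL-Analysis.Analysis" "HOL-Algebra.Generated_Groups"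
begin

locale topological_group = group G for G (structure) +
  fixes T :: "'a topology"
  assumes topspace_eq_carrier: "topspace T = carrier G"
    and continuous_mult:
      "continuous_map (prod_topology T T) T (\<lambda>p. fst p \<otimes>\<^bsub>G\<^esub> snd p)"
    and continuous_inverse: "continuous_map T T (m_inv G)"

definition sigma_compact_space :: "'a topology \<Rightarrow> bool" where
  "sigma_compact_space X \<longleftrightarrow> (countable union_of compactin X) (topspace X)"

definition borel_sets_in :: "'a topology \<Rightarrow> 'a set set" where
  "borel_sets_in X = sigma_sets (topspace X) {U. openin X U}"

definition is_completion :: "'a metric \<Rightarrow> 'b metric \<Rightarrow> ('a \<Rightarrow> 'b) \<Rightarrow> bool" where
  "is_completion m c f \<longleftrightarrow>
     mcomplete_of c \<and>
     f \<in> mspace m \<rightarrow> mspace c \<and>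
     (\<forall>x\<in>mspace m. \<forall>y\<in>mspace m. mdist c (f x) (f y) = mdist m x y) \<and>
     mtopology_of c closure_of (f ` mspace m) = mspace c"

text \<open>
  The type of points of the completion is fixed to be \<open>'a \<Rightarrow> real\<close> because one cannot
  quantify over types inside a definition. By \<open>Metric_space.metric_completion\<close> every
  metric on \<open>'a\<close> has a completion there, and completions are unique up to isometry, so this is
  no restriction. The condition does not depend on the choice of the compatible metric
  \<open>m\<close> (for separable spaces, being Borel in one separable completely metrizable space is
  equivalent to being Borel in all of them). Metrizability is implied by the existence of
  \<open>m\<close>.
\<close>

definition Borel_space :: "'a topology \<Rightarrow> bool" where
  "Borel_space X \<longleftrightarrow>
     separable_space X \<and>
     (\<exists>m. mtopology_of m = X \<and>
        (\<exists>(c :: ('a \<Rightarrow> real) metric) f.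
           is_completion m c f \<and> f ` mspace m \<in> borel_sets_in (mtopology_of c)))"

definition open_cover_of :: "'a topology \<Rightarrow> 'a set set \<Rightarrow> bool" where
  "open_cover_of X \<U> \<longleftrightarrow> (\<forall>U\<in>\<U>. openin X U) \<and> \<Union>\<U> = topspace X"

definition Hurewicz_space :: "'a topology \<Rightarrow> bool" where
  "Hurewicz_space X \<longleftrightarrow>
     (\<forall>u :: nat \<Rightarrow> 'a set set. (\<forall>n. open_cover_of X (u n)) \<longrightarrow>
        (\<exists>v. (\<forall>n. finite (v n) \<and> v n \<subseteq> u n) \<and>
             (\<forall>x\<in>topspace X. \<forall>\<^sub>F n in sequentially. x \<in> \<Union>(v n))))"

end

theory Submission
  imports Defs
begin

text \<open>
  In a complete metric space a subspace \<open>S\<close> with the Hurewicz property lies in a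
  \<open>\<sigma>\<close>-compact subset: apply the property to the covers of \<open>S\<close> by balls of radius
  \<open>1/(n+1)\<close>; the points that belong to \<open>\<Union>(v n)\<close> for all \<open>n \<ge> N\<close> form a totally bounded set,
  whose closure is compact by completeness, and \<open>S\<close> is the union of these sets over \<open>N\<close>.
  If \<open>B\<close> is \<open>G\<^sub>\<delta>\<close> in a complete space it is completely metrizable itself, and if it is
  \<open>F\<^sub>\<sigma>\<close> then its trace on a \<open>\<sigma>\<close>-compact set is \<open>\<sigma>\<close>-compact; in both cases the subspace \<open>X\<close>
  is contained in a \<open>\<sigma>\<close>-compact subset of \<open>B\<close>. The set of all products of elements of a
  \<open>\<sigma>\<close>-compact set and their inverses is \<open>\<sigma>\<close>-compact, so \<open>X\<close> generating \<open>B\<close> would make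
  \<open>B\<close> \<open>\<sigma>\<close>-compact.
\<close>

section \<open>Hurewicz subspaces of complete spaces\<close>

text \<open>Covers of the image are pulled back to \<open>X\<close>, and the finite selections made
  there are pushed forward again. This carries a Hurewicz subspace through the embedding
  \<open>e\<close> in the \<open>F_sigma\<close> case.\<close>

lemma Hurewicz_space_continuous_map_image:
  assumes "Hurewicz_space X" and f: "continuous_map X Y f"
  shows "Hurewicz_space (subtopology Y (f ` topspace X))"
  unfolding Hurewicz_space_def
proof (intro allI impI)
  fix u :: "nat \<Rightarrow> 'b set set"
  let ?Z = "subtopology Y (f ` topspace X)"
  assume u: "\<forall>n. open_cover_of ?Z (u n)"
  have im: "f ` topspace X \<subseteq> topspace Y"
    using f by (rule continuous_map_image_subset_topspace)
  \<comment> \<open>The members of \<open>u n\<close> are open in the image \<open>?Z\<close>, not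
    necessarily in \<open>Y\<close>, so preimages are taken for \<open>f\<close> as a map into
    \<open>?Z\<close>.\<close>
  have f': "continuous_map X ?Z f"
    using f by (simp add: continuous_map_in_subtopology)
  define pre where "pre U = {x \<in> topspace X. f x \<in> U}" for U
  have "open_cover_of X (pre ` u n)" for n
  proof -
    have "openin X (pre U)" if "U \<in> u n" for U
      using openin_continuous_map_preimage[OF f', of U] u that
      by (auto simp: pre_def open_cover_of_def)
    moreover have "\<Union>(pre ` u n) = topspace X"
    proof -
      have "\<Union>(u n) = f ` topspace X"
        using u im by (auto simp: open_cover_of_def)
      then have "f x \<in> \<Union>(u n)" if "x \<in> topspace X" for x
        using that by simp
      then show ?thesis
        by (fastforce simp: pre_def)
    qed
    ultimately show ?thesis
      by (auto simp: open_cover_of_def)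
  qed
  then have "\<exists>v'. (\<forall>n. finite (v' n) \<and> v' n \<subseteq> pre ` u n) \<and>
      (\<forall>x\<in>topspace X. \<forall>\<^sub>F n in sequentially. x \<in> \<Union>(v' n))"
    using assms(1)[unfolded Hurewicz_space_def, THEN spec, of "\<lambda>n. pre ` u n"] by simp
  then obtain v' where fin': "\<And>n. finite (v' n)" and sub': "\<And>n. v' n \<subseteq> pre ` u n"
    and ev': "\<And>x. x \<in> topspace X \<Longrightarrow> \<forall>\<^sub>F n in sequentially. x \<in> \<Union>(v' n)"
    by metis
  \<comment> \<open>Each finite family of preimages is lifted to a finite subfamily of
    \<open>u n\<close>.\<close>
  have "\<forall>n. \<exists>w. w \<subseteq> u n \<and> finite w \<and> v' n = pre ` w"
    using finite_subset_image[OF fin' sub'] by metis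
  then obtain v where v: "\<And>n. v n \<subseteq> u n" "\<And>n. finite (v n)" "\<And>n. v' n = pre ` v n"
    by metis
  have "\<forall>\<^sub>F n in sequentially. y \<in> \<Union>(v n)" if y: "y \<in> topspace ?Z" for y
  proof -
    obtain x where x: "x \<in> topspace X" "y = f x"
      using y by auto
    show ?thesis
      using ev'[OF x(1)] by (rule eventually_mono) (auto simp: v(3) pre_def x(2))
  qed
  with v show "\<exists>v. (\<forall>n. finite (v n) \<and> v n \<subseteq> u n) \<and>
      (\<forall>y\<in>topspace ?Z. \<forall>\<^sub>F n in sequentially. y \<in> \<Union>(v n))"
    by (intro exI[of _ v]) simp
qed

lemma (in Metric_space) Hurewicz_subspace_subset_sigma_compact:
  assumes "mcomplete" and "S \<subseteq> M" and "Hurewicz_space (subtopology mtopology S)"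
  obtains K where "(countable union_of compactin mtopology) K" "S \<subseteq> K"
proof -
  \<comment> \<open>The balls are cut down to \<open>S\<close> because a cover of the subspace must
    have union exactly \<open>S\<close>.\<close>
  define u where "u n = (\<lambda>x. S \<inter> mball x (1 / real (Suc n))) ` S" for n :: nat
  have top: "topspace (subtopology mtopology S) = S"
    using assms(2) by auto
  have "open_cover_of (subtopology mtopology S) (u n)" for n
  proof -
    have "\<Union>(u n) = S"
      using assms(2) by (auto simp: u_def)
    then show ?thesis
      unfolding open_cover_of_def top
      by (auto simp: u_def openin_subtopology_Int2)
  qed
  then obtain v where fin: "\<And>n. finite (v n)" and sub: "\<And>n. v n \<subseteq> u n"
    and ev: "\<And>x. x \<in> S \<Longrightarrow> \<forall>\<^sub>F n in sequentially. x \<in> \<Union>(v n)"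
    using assms(3)[unfolded Hurewicz_space_def top, rule_format, of u] by blast
  define L where "L N = {x \<in> S. \<forall>n\<ge>N. x \<in> \<Union>(v n)}" for N
  have LM: "L N \<subseteq> M" for N
    using assms(2) by (auto simp: L_def)
  have tb: "mtotally_bounded (L N)" for N
    unfolding mtotally_bounded_def
  proof (intro allI impI)
    fix \<epsilon> :: real assume "\<epsilon> > 0"
    then obtain k where k: "1 / real (Suc k) < \<epsilon> / 2"
      using nat_approx_posE[of "\<epsilon> / 2"] by auto
    \<comment> \<open>From \<open>n \<ge> N\<close> it follows that \<open>v n\<close> covers
      \<open>L N\<close>; from \<open>n \<ge> k\<close>, that its balls have radius below
      \<epsilon>/2.\<close>
    define n where "n = max N k"
    have "1 / real (Suc n) \<le> 1 / real (Suc k)"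
      by (simp add: n_def frac_le)
    with k have n: "1 / real (Suc n) < \<epsilon> / 2" by linarith
    \<comment> \<open>Total boundedness asks for centres in \<open>L N\<close>, but the centres of
      the balls in \<open>v n\<close> are only known to lie in \<open>S\<close>. Each member that
      meets \<open>L N\<close> is therefore recentred at a point \<open>p U\<close> of
      \<open>L N\<close>, which at most doubles the radius.\<close>
    define W where "W = {U \<in> v n. U \<inter> L N \<noteq> {}}"
    have "\<forall>U\<in>W. \<exists>p. p \<in> U \<inter> L N"
      by (auto simp: W_def)
    then obtain p where p: "\<And>U. U \<in> W \<Longrightarrow> p U \<in> U \<inter> L N"
      by metis
    have "L N \<subseteq> (\<Union>x\<in>p ` W. mball x \<epsilon>)"
    proof
      fix y assume y: "y \<in> L N"
      then have "y \<in> \<Union>(v n)"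
        by (auto simp: L_def n_def)
      then obtain U where U: "U \<in> v n" "y \<in> U" by auto
      with y have UW: "U \<in> W" by (auto simp: W_def)
      obtain x where x: "U = S \<inter> mball x (1 / real (Suc n))"
        using sub U(1) by (auto simp: u_def)
      have "d x (p U) < 1 / real (Suc n)" "d x y < 1 / real (Suc n)" "x \<in> M" "y \<in> M" "p U \<in> M"
        using p[OF UW] U(2) x by auto
      then have "y \<in> mball (p U) \<epsilon>"
        using triangle[of "p U" x y] n commute[of "p U" x] by auto
      with UW show "y \<in> (\<Union>x\<in>p ` W. mball x \<epsilon>)" by auto
    qed
    moreover have "finite (p ` W)" "p ` W \<subseteq> L N"
      using fin p by (auto simp: W_def)
    ultimately show "\<exists>K. finite K \<and> K \<subseteq> L N \<and> L N \<subseteq> (\<Union>x\<in>K. mball x \<epsilon>)"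
      by blast
  qed
  let ?K = "\<Union>N. mtopology closure_of L N"
  show thesis
  proof
    have "compactin mtopology (mtopology closure_of L N)" for N
      using tb mtotally_bounded_eq_compact_closure_of[OF assms(1)] by blast
    then show "(countable union_of compactin mtopology) ?K"
      by (intro countable_union_of_UN) (auto intro: countable_union_of_inc)
    show "S \<subseteq> ?K"
    proof
      fix x assume x: "x \<in> S"
      then obtain N where "x \<in> L N"
        using ev[OF x] by (auto simp: L_def eventually_sequentially)
      then show "x \<in> ?K"
        using closure_of_subset[of "L N" mtopology] LM by auto
    qed
  qed
qed

lemma Hurewicz_subspace_subset_sigma_compact:
  assumes "completely_metrizable_space X" and "S \<subseteq> topspace X"
    and "Hurewicz_space (subtopology X S)"
  obtains K where "(countable union_of compactin X) K" "S \<subseteq> K"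
proof -
  obtain M d where "Metric_space M d" and c: "Metric_space.mcomplete M d"
    and X: "X = Metric_space.mtopology M d"
    using assms(1) by (auto simp: completely_metrizable_space_def)
  then interpret Metric_space M d by simp
  show thesis
    using Hurewicz_subspace_subset_sigma_compact[OF c] assms(2,3) that
    unfolding X by auto
qed

section \<open>Stability properties of sigma-compact sets\<close>

lemma sigma_compact_Int_fsigma_in:
  assumes "(countable union_of compactin X) K" and "fsigma_in X F"
  shows "(countable union_of compactin X) (K \<inter> F)"
proof -
  obtain \<K> where \<K>: "countable \<K>" "\<And>C. C \<in> \<K> \<Longrightarrow> compactin X C" "\<Union>\<K> = K"
    using assms(1) by (auto simp: union_of_def)
  obtain \<F> where \<F>: "countable \<F>" "\<And>C. C \<in> \<F> \<Longrightarrow> closedin X C" "\<Union>\<F> = F"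
    using assms(2) by (auto simp: fsigma_in_def union_of_def)
  have "K \<inter> F = (\<Union>(C, D)\<in>\<K> \<times> \<F>. C \<inter> D)"
    using \<K>(3) \<F>(3) by auto
  moreover have "(countable union_of compactin X) (\<Union>(C, D)\<in>\<K> \<times> \<F>. C \<inter> D)"
    using \<K> \<F> by (intro countable_union_of_UN) (auto intro!: countable_union_of_inc compact_Int_closedin)
  ultimately show ?thesis by simp
qed

lemma sigma_compact_continuous_map_image:
  assumes "(countable union_of compactin X) K" and "continuous_map X Y f"
  shows "(countable union_of compactin Y) (f ` K)"
proof -
  obtain \<K> where \<K>: "countable \<K>" "\<And>C. C \<in> \<K> \<Longrightarrow> compactin X C" "\<Union>\<K> = K"
    using assms(1) by (auto simp: union_of_def)
  have "f ` K = (\<Union>C\<in>\<K>. f ` C)"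
    using \<K>(3) by auto
  moreover have "(countable union_of compactin Y) (\<Union>C\<in>\<K>. f ` C)"
    using \<K> assms(2)
    by (intro countable_union_of_UN) (auto intro!: countable_union_of_inc image_compactin)
  ultimately show ?thesis by simp
qed

lemma sigma_compact_Times:
  assumes "(countable union_of compactin X) K" and "(countable union_of compactin Y) L"
  shows "(countable union_of compactin (prod_topology X Y)) (K \<times> L)"
proof -
  obtain \<K> where \<K>: "countable \<K>" "\<And>C. C \<in> \<K> \<Longrightarrow> compactin X C" "\<Union>\<K> = K"
    using assms(1) by (auto simp: union_of_def)
  obtain \<L> where \<L>: "countable \<L>" "\<And>C. C \<in> \<L> \<Longrightarrow> compactin Y C" "\<Union>\<L> = L"
    using assms(2) by (auto simp: union_of_def)
  have "K \<times> L = (\<Union>(C, D)\<in>\<K> \<times> \<L>. C \<times> D)"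
    using \<K>(3) \<L>(3) by auto
  moreover have "(countable union_of compactin (prod_topology X Y)) (\<Union>(C, D)\<in>\<K> \<times> \<L>. C \<times> D)"
    using \<K> \<L>
    by (intro countable_union_of_UN) (auto intro!: countable_union_of_inc simp: compactin_Times)
  ultimately show ?thesis by simp
qed

lemma sigma_compact_subtopology:
  assumes "(countable union_of compactin X) K" and "K \<subseteq> S"
  shows "(countable union_of compactin (subtopology X S)) K"
  using assms by (fastforce simp: union_of_def compactin_subtopology)

lemma sigma_compact_subset_topspace:
  "(countable union_of compactin X) K \<Longrightarrow> K \<subseteq> topspace X"
  by (auto simp: union_of_def dest: compactin_subset_topspace)

section \<open>Transfer along the embedding into a complete space\<close>

lemma Hurewicz_subspace_subset_sigma_compact_embedding:
  assumes Z: "completely_metrizable_space Z" and e: "embedding_map T Z e"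
    and FG: "fsigma_in Z (e ` topspace T) \<or> gdelta_in Z (e ` topspace T)"
    and X: "X \<subseteq> topspace T" and H: "Hurewicz_space (subtopology T X)"
  obtains K where "(countable union_of compactin T) K" "X \<subseteq> K"
  using FG
proof
  let ?E = "e ` topspace T"
  assume F: "fsigma_in Z ?E"
  obtain g where g: "homeomorphic_maps T (subtopology Z ?E) e g"
    using e by (auto simp: embedding_map_def homeomorphic_map_maps)
  have ce: "continuous_map T Z e" and cg: "continuous_map (subtopology Z ?E) T g"
    and ge: "\<And>x. x \<in> topspace T \<Longrightarrow> g (e x) = x"
    using g by (auto simp: homeomorphic_maps_def continuous_map_in_subtopology)
  have "topspace (subtopology T X) = X"
    using X by auto
  with Hurewicz_space_continuous_map_image[OF H continuous_map_from_subtopology[OF ce]]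
  have "Hurewicz_space (subtopology Z (e ` X))"
    by simp
  moreover have "e ` X \<subseteq> topspace Z"
    using X continuous_map_image_subset_topspace[OF ce] by auto
  ultimately obtain K where K: "(countable union_of compactin Z) K" "e ` X \<subseteq> K"
    using Hurewicz_subspace_subset_sigma_compact[OF Z] by blast
  \<comment> \<open>The inverse \<open>g\<close> is continuous only on \<open>?E\<close>, so
    \<open>K\<close> is cut down to \<open>?E\<close> and viewed in that subspace before it is
    mapped back to \<open>T\<close>.\<close>
  have "(countable union_of compactin (subtopology Z ?E)) (K \<inter> ?E)"
    using sigma_compact_Int_fsigma_in[OF K(1) F] by (rule sigma_compact_subtopology) simp
  then have "(countable union_of compactin T) (g ` (K \<inter> ?E))"
    using cg by (rule sigma_compact_continuous_map_image)
  moreover have "X \<subseteq> g ` (K \<inter> ?E)"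
  proof
    fix x assume x: "x \<in> X"
    then have "e x \<in> K \<inter> ?E" "x = g (e x)"
      using K(2) X ge by auto
    then show "x \<in> g ` (K \<inter> ?E)" by blast
  qed
  ultimately show thesis by (rule that)
next
  assume "gdelta_in Z (e ` topspace T)"
  \<comment> \<open>Alexandrov's theorem on \<open>G_delta\<close> subspaces; complete metrizability
    then passes to \<open>T\<close> by homeomorphism.\<close>
  then have "completely_metrizable_space (subtopology Z (e ` topspace T))"
    using Z by (simp add: completely_metrizable_space_gdelta_in)
  then have "completely_metrizable_space T"
    using embedding_map_imp_homeomorphic_space[OF e] homeomorphic_completely_metrizable_space
    by blast
  then show thesis
    using Hurewicz_subspace_subset_sigma_compact X H that by blast
qed

section \<open>Subgroups generated inside sigma-compact sets\<close>

lemma (in topological_group) sigma_compact_set_mult: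
  assumes "(countable union_of compactin T) K" and "(countable union_of compactin T) L"
  shows "(countable union_of compactin T) (K <#> L)"
proof -
  have "K <#> L = (\<lambda>p. fst p \<otimes> snd p) ` (K \<times> L)"
    by (force simp: set_mult_def)
  then show ?thesis
    using sigma_compact_continuous_map_image[OF sigma_compact_Times[OF assms] continuous_mult]
    by simp
qed

lemma (in topological_group) sigma_compact_generate:
  assumes K: "(countable union_of compactin T) K"
    and X: "X \<subseteq> K" and gen: "generate G X = carrier G"
  shows "sigma_compact_space T"
proof -
  let ?sc = "countable union_of compactin T"
  have KG: "K \<subseteq> carrier G"
    using sigma_compact_subset_topspace[OF K] topspace_eq_carrier by simp
  \<comment> \<open>Adding the inverses makes products suffice, and adding \<one> makes the sets
    \<open>W n\<close> increase. \<open>W n\<close> consists of the products of \<open>2 ^ n\<close>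
    factors from \<open>A\<close>.\<close>
  define A where "A = insert \<one> (K \<union> m_inv G ` K)"
  define W where "W n = ((\<lambda>S. S <#> S) ^^ n) A" for n :: nat
  have W0: "W 0 = A" and WS: "\<And>n. W (Suc n) = W n <#> W n"
    by (simp_all add: W_def)
  have "?sc {\<one>}"
    by (rule countable_union_of_inc) (simp add: topspace_eq_carrier)
  then have "?sc ({\<one>} \<union> (K \<union> m_inv G ` K))"
    using K sigma_compact_continuous_map_image[OF K continuous_inverse]
    by (intro countable_union_of_Un)
  then have A: "?sc A"
    by (simp add: A_def)
  have W: "?sc (W n)" for n
    by (induction n) (use A in \<open>auto simp: W0 WS intro: sigma_compact_set_mult\<close>)
  then have WG: "W n \<subseteq> carrier G" for n
    using sigma_compact_subset_topspace topspace_eq_carrier by metis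
  have one: "\<one> \<in> W n" for n
    by (induction n) (force simp: W0 WS A_def set_mult_def)+
  have "W n \<subseteq> W (Suc n)" for n
  proof
    fix x assume x: "x \<in> W n"
    then have "x \<in> carrier G"
      using WG by blast
    then have "x = x \<otimes> \<one>"
      by simp
    with x one show "x \<in> W (Suc n)"
      unfolding WS set_mult_def by blast
  qed
  then have mono: "m \<le> n \<Longrightarrow> W m \<subseteq> W n" for m n
    by (rule lift_Suc_mono_le)
  have "generate G X \<subseteq> (\<Union>n. W n)"
  proof
    fix x assume "x \<in> generate G X"
    then show "x \<in> (\<Union>n. W n)"
    proof (induction rule: generate.induct)
      case one
      then show ?case using \<open>\<one> \<in> W 0\<close> by blast
    next
      case (incl h)
      then have "h \<in> W 0" using X by (auto simp: W0 A_def)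
      then show ?case by blast
    next
      case (inv h)
      then have "inv h \<in> W 0" using X by (auto simp: W0 A_def)
      then show ?case by blast
    next
      \<comment> \<open>By monotonicity both factors lie in one \<open>W k\<close>, and squaring
        that set gives the next stage.\<close>
      case (eng h1 h2)
      then obtain m n where "h1 \<in> W m" "h2 \<in> W n" by blast
      then have "h1 \<in> W (max m n)" "h2 \<in> W (max m n)"
        using mono[of m "max m n"] mono[of n "max m n"] by auto
      then have "h1 \<otimes> h2 \<in> W (Suc (max m n))"
        unfolding WS set_mult_def by blast
      then show ?case by blast
    qed
  qed
  \<comment> \<open>One inclusion holds because \<open>X\<close> generates the group, the other
    because every \<open>W n\<close> lies in the carrier.\<close>
  then have "topspace T = (\<Union>n. W n)"
    using gen WG topspace_eq_carrier by auto
  moreover have "?sc (\<Union>n. W n)"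
    using W by (intro countable_union_of_UN) auto
  ultimately show ?thesis
    by (simp add: sigma_compact_space_def)
qed

theorem proposition5:
  fixes B :: "('a, 'm) monoid_scheme" and T :: "'a topology"
    and C :: "'b metric" and e :: "'a \<Rightarrow> 'b"
  assumes "topological_group B T"
    and "Borel_space T"
    and "\<not> sigma_compact_space T"
    and "mcomplete_of C"
    and "embedding_map T (mtopology_of C) e"
    and "fsigma_in (mtopology_of C) (e ` topspace T) \<or>
         gdelta_in (mtopology_of C) (e ` topspace T)"
  shows "\<not> (\<exists>X. X \<subseteq> carrier B \<and> Hurewicz_space (subtopology T X) \<and>
                generate B X = carrier B)"
proof
  interpret topological_group B T by fact
  assume "\<exists>X. X \<subseteq> carrier B \<and> Hurewicz_space (subtopology T X) \<and> generate B X = carrier B"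
  then obtain X where X: "X \<subseteq> carrier B" "Hurewicz_space (subtopology T X)"
    "generate B X = carrier B" by blast
  interpret C: Metric_space "mspace C" "mdist C"
    by (rule Metric_space_mspace_mdist)
  have "completely_metrizable_space (mtopology_of C)"
    using assms(4) C.completely_metrizable_space_mtopology
    by (simp add: mcomplete_of_def mtopology_of_def)
  then obtain K where "(countable union_of compactin T) K" "X \<subseteq> K"
    using Hurewicz_subspace_subset_sigma_compact_embedding[OF _ assms(5,6) _ X(2)]
      X(1) topspace_eq_carrier by metis
  then have "sigma_compact_space T"
    using X(3) by (rule sigma_compact_generate)
  with assms(3) show False by contradiction
qed

end
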